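(* Let $k\in\mathbb{Z}_{>0}$ and $a\in\frac{k}{2}+\mathbb{Z}$ with $a\ge 0$. Write $q=e^{2\pi i\tau}$ ($\tau$ in the upper half-plane) and $\zeta=e^{2\pi i z}$, and let $$F_k(z;\tau):=\left(\frac{-\vartheta\left(z+\frac12;\tau\right)}{q^{\frac1{12}}\eta(\tau)}\right)^k .$$ Then the $\zeta^a$-coefficient of $F_k(z;\tau)$ (i.e. the coefficient of $e^{2\pi i a z}$ in its expansion) is $$C\Psi_{k,a}(q)=\sum_{n\ge 0}c\psi_{k,a}(n)q^n,$$ where $c\psi_{k,a}(n)$ is the number of $(k,a)$-colored F-partitions of weight $n$. In particular $C\Psi_{k,k/2}(q)=C\Phi_k(q)$.
   Context: $\vartheta(z;\tau):=\sum_{n\in\frac12+\mathbb{Z}}e^{\pi i n^2\tau+2\pi i n(z+\frac12)}$ for $z\in\mathbb{C}$, $\tau$ in the upper half-plane; $\eta(\tau)=q^{1/24}\prod_{n\ge1}(1-q^n)$; $q^x:=e^{2\pi i x\tau}$ for rational $x$. Colored integers: an entry is a pair $m_j$ consisting of a nonnegative integer $m$ and a color $j\in\{1,\dots,k\}$ (i.e. it lies in the $j$-th of $k$ copies of $\mathbb{Z}_{\ge0}$). They are ordered lexicographically: $m_j<n_\ell$ iff $m<n$, or $m=n$ and $j<\ell$. A $(k,a)$-colored F-partition is a two-rowed array $\begin{pmatrix}a_1&\cdots&a_r\\ b_1&\cdots&b_s\end{pmatrix}$ ($r,s\ge0$) whose entries are colored nonnegative integers, each row strictly decreasing in the lexicographic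 order, with $r-s=a-\frac{k}{2}$. Its weight is $r+\sum_{\ell=1}^r a_\ell+\sum_{j=1}^s b_j$ (the values, not colors, are summed). $c\psi_{k,a}(n)$ is the number of such arrays of weight $n$. A $k$-colored Frobenius partition of $n$ is such an array with $r=s$ and weight $n$ (i.e. the case $a=k/2$); $c\phi_k(n)$ counts them (with $c\phi_k(0)=1$ from the empty array) and $C\Phi_k(q):=\sum_{n\ge0}c\phi_k(n)q^n$. *)

theory Defs
  imports "HOL-Analysis.Analysis"
begin

definition qpow :: "complex \<Rightarrow> real \<Rightarrow> complex" where
  "qpow \<tau> x = exp (2 * of_real pi * \<i> * of_real x * \<tau>)"

definition vartheta :: "complex \<Rightarrow> complex \<Rightarrow> complex" where
  "vartheta z \<tau> =
     (\<Sum>\<^sub>\<infinity>n\<in>{n::real. n - 1/2 \<in> \<int>}.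
        exp (of_real pi * \<i> * (of_real n)\<^sup>2 * \<tau> + 2 * of_real pi * \<i> * of_real n * (z + 1/2)))"

definition eta :: "complex \<Rightarrow> complex" where
  "eta \<tau> = qpow \<tau> (1/24) * (\<Prod>n. 1 - qpow \<tau> (real (Suc n)))"

definition F_fun :: "nat \<Rightarrow> complex \<Rightarrow> complex \<Rightarrow> complex" where
  "F_fun k z \<tau> = (- vartheta (z + 1/2) \<tau> / (qpow \<tau> (1/12) * eta \<tau>)) ^ k"

(* c gives the coefficients of an expansion of f in powers of \<zeta> = exp (2 \<pi> \<i> z) with
   exponents in h + \<int>, valid for every complex z.  Half-integral exponents are why this is
   not phrased as a Laurent series in \<zeta>; values of c off h + \<int> are irrelevant. *)
definition zeta_expansion :: "real \<Rightarrow> (complex \<Rightarrow> complex) \<Rightarrow> (real \<Rightarrow> complex) \<Rightarrow> bool" where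
  "zeta_expansion h f c \<longleftrightarrow>
     (\<forall>z. ((\<lambda>b. c b * exp (2 * of_real pi * \<i> * of_real b * z)) has_sum f z) {b. b - h \<in> \<int>})"

(* The entry m_j, of value m and color j, is the pair (m, j).  The order is spelled out because
   HOL-Analysis already orders pairs componentwise. *)
type_synonym entry = "nat \<times> nat"

definition entry_less :: "entry \<Rightarrow> entry \<Rightarrow> bool" where
  "entry_less x y \<longleftrightarrow> fst x < fst y \<or> (fst x = fst y \<and> snd x < snd y)"

definition is_row :: "nat \<Rightarrow> entry list \<Rightarrow> bool" where
  "is_row k xs \<longleftrightarrow> (\<forall>x\<in>set xs. snd x \<in> {1..k}) \<and> sorted_wrt (\<lambda>x y. entry_less y x) xs"

definition F_partitions :: "nat \<Rightarrow> real \<Rightarrow> (entry list \<times> entry list) set" where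
  "F_partitions k a =
     {(as, bs). is_row k as \<and> is_row k bs \<and>
        real (length as) - real (length bs) = a - real k / 2}"

definition Frobenius_partitions :: "nat \<Rightarrow> (entry list \<times> entry list) set" where
  "Frobenius_partitions k =
     {(as, bs). is_row k as \<and> is_row k bs \<and> length as = length bs}"

definition weight :: "entry list \<times> entry list \<Rightarrow> nat" where
  "weight p = length (fst p) + sum_list (map fst (fst p)) + sum_list (map fst (snd p))"

definition c_psi :: "nat \<Rightarrow> real \<Rightarrow> nat \<Rightarrow> nat" where
  "c_psi k a n = card {p \<in> F_partitions k a. weight p = n}"

definition c_phi :: "nat \<Rightarrow> nat \<Rightarrow> nat" where
  "c_phi k n = card {p \<in> Frobenius_partitions k. weight p = n}"

definition C_Psi :: "nat \<Rightarrow> real \<Rightarrow> complex fps" where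
  "C_Psi k a = Abs_fps (\<lambda>n. of_nat (c_psi k a n))"

definition C_Phi :: "nat \<Rightarrow> complex fps" where
  "C_Phi k = Abs_fps (\<lambda>n. of_nat (c_phi k n))"

(* The sets counted by c_psi and c_phi are finite, so card is a genuine count. *)

lemma is_row_distinct: "is_row k xs \<Longrightarrow> distinct xs"
  unfolding is_row_def by (induction xs) (auto simp: entry_less_def)

lemma finite_rows_weight:
  "finite {p. is_row k (fst p) \<and> is_row k (snd p) \<and> weight p = n}"
proof (rule finite_subset)
  let ?R = "{xs. set xs \<subseteq> {..n} \<times> {1..k} \<and> distinct xs}"
  show "{p. is_row k (fst p) \<and> is_row k (snd p) \<and> weight p = n} \<subseteq> ?R \<times> ?R"
  proof (rule subsetI)
    fix p assume "p \<in> {p. is_row k (fst p) \<and> is_row k (snd p) \<and> weight p = n}"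
    then have rows: "is_row k (fst p)" "is_row k (snd p)" and n: "weight p = n"
      by auto
    have le: "fst x \<le> n" if "x \<in> set (fst p) \<union> set (snd p)" for x
      using that member_le_sum_list[of "fst x" "map fst (fst p)"]
        member_le_sum_list[of "fst x" "map fst (snd p)"] n
      by (auto simp: weight_def)
    have "xs \<in> ?R" if "is_row k xs" "set xs \<subseteq> set (fst p) \<union> set (snd p)" for xs
      using that le is_row_distinct[of k xs] unfolding is_row_def by fastforce
    with rows show "p \<in> ?R \<times> ?R"
      by (simp add: mem_Times_iff)
  qed
  show "finite (?R \<times> ?R)"
    by (intro finite_cartesian_product finite_subset_distinct) auto
qed

lemma finite_F_partitions_weight: "finite {p \<in> F_partitions k a. weight p = n}"
  by (rule finite_subset[OF _ finite_rows_weight[of k n]]) (auto simp: F_partitions_def)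

lemma finite_Frobenius_partitions_weight: "finite {p \<in> Frobenius_partitions k. weight p = n}"
  by (rule finite_subset[OF _ finite_rows_weight[of k n]]) (auto simp: Frobenius_partitions_def)

end

theory Submission
  imports Defs
begin

text \<open>With \<open>q = exp (2 \<pi> \<i> \<tau>)\<close> and \<open>\<zeta> = exp (2 \<pi> \<i> z)\<close>, the array with rows \<open>A\<close> and \<open>B\<close> contributes
  the product of the factors \<open>\<zeta> q\<^bsup>m + 1\<^esup>\<close> over the entries \<open>m\<close> of \<open>A\<close> and \<open>\<zeta>\<^bsup>-1\<^esup> q\<^bsup>m\<^esup>\<close> over those of
  \<open>B\<close>. The sum of such products over all finite sets of entries converges absolutely and is
  multiplicative in the set of colors, so it is the \<open>k\<close>-th power of the one-color sum. For one color,
  truncating to entries below \<open>N\<close> and applying the \<open>q\<close>-binomial theorem shows that the coefficient of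
  \<open>\<zeta>\<^bsup>m\<^esup>\<close> is a Gaussian binomial coefficient times \<open>q\<^bsup>m (m + 1) / 2\<^esup>\<close>; letting \<open>N\<close> tend to infinity gives
  \<open>q\<^bsup>m (m + 1) / 2\<^esup> / \<Prod>\<^bsub>n \<ge> 1\<^esub> (1 - q\<^bsup>n\<^esup>)\<close>, which is the coefficient of the theta quotient.\<close>

section \<open>Sums over finite subsets\<close>

text \<open>The expanded form of the product of \<open>1 + f x\<close> over \<open>X\<close>. A sum
  over finite subsets fixes no enumeration of \<open>X\<close> and can be regrouped by
  charge.\<close>

definition subset_prod_sum :: "('i \<Rightarrow> complex) \<Rightarrow> 'i set \<Rightarrow> complex" where
  "subset_prod_sum f X = (\<Sum>\<^sub>\<infinity>S\<in>Fpow X. \<Prod>x\<in>S. f x)"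

lemma sum_Pow_prod:
  fixes f :: "'i \<Rightarrow> 'a::comm_semiring_1"
  assumes "finite X"
  shows "(\<Sum>S\<in>Pow X. \<Prod>x\<in>S. f x) = (\<Prod>x\<in>X. 1 + f x)"
  using prod_add[OF assms, of f "\<lambda>_. 1"] by (simp add: add.commute)

text \<open>Any finite family of finite subsets lies in \<open>Pow T\<close> for a finite
  \<open>T\<close>, where the sum of norms factors into a product of terms
  \<open>1 + norm (f x)\<close>. As \<open>1 + t \<le> exp t\<close>, all partial sums are bounded
  by the exponential of the total norm.\<close>

lemma summable_on_Fpow_prod:
  fixes f :: "'i \<Rightarrow> complex"
  assumes "(\<lambda>x. norm (f x)) summable_on X"
  shows "(\<lambda>S. \<Prod>x\<in>S. f x) summable_on Fpow X"
proof (rule abs_summable_summable, rule nonneg_bdd_above_summable_on)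
  let ?I = "\<Sum>\<^sub>\<infinity>x\<in>X. norm (f x)"
  show "bdd_above (sum (\<lambda>S. norm (\<Prod>x\<in>S. f x)) ` {F. F \<subseteq> Fpow X \<and> finite F})"
  proof (rule bdd_aboveI2)
    fix F assume F: "F \<in> {F. F \<subseteq> Fpow X \<and> finite F}"
    define T where "T = \<Union>F"
    have T: "finite T" "T \<subseteq> X" "F \<subseteq> Pow T"
      using F by (auto simp: T_def Fpow_def)
    have "(\<Sum>S\<in>F. norm (\<Prod>x\<in>S. f x)) = (\<Sum>S\<in>F. \<Prod>x\<in>S. norm (f x))"
      by (simp add: prod_norm)
    also have "\<dots> \<le> (\<Sum>S\<in>Pow T. \<Prod>x\<in>S. norm (f x))"
      using T by (intro sum_mono2) (auto intro: prod_nonneg)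
    also have "\<dots> = (\<Prod>x\<in>T. 1 + norm (f x))"
      by (rule sum_Pow_prod) (rule T)
    also have "\<dots> \<le> exp (\<Sum>x\<in>T. norm (f x))"
      by (intro prod_le_exp_sum) auto
    also have "\<dots> \<le> exp ?I"
      using finite_sum_le_infsum[of "\<lambda>x. norm (f x)" X T] assms T by auto
    finally show "(\<Sum>S\<in>F. norm (\<Prod>x\<in>S. f x)) \<le> exp ?I" .
  qed
qed auto

text \<open>A finite subset of a disjoint union is a pair of finite subsets, and its product factors
  accordingly; the double sum is then evaluated as an iterated one.\<close>

lemma subset_prod_sum_Un:
  assumes "(\<lambda>x. norm (f x)) summable_on X \<union> Y" and disj: "X \<inter> Y = {}"
  shows "subset_prod_sum f (X \<union> Y) = subset_prod_sum f X * subset_prod_sum f Y"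
proof -
  have sX: "(\<lambda>x. norm (f x)) summable_on X" and sY: "(\<lambda>x. norm (f x)) summable_on Y"
    using assms(1) by (auto intro: summable_on_subset_banach)
  note hX = has_sum_infsum[OF summable_on_Fpow_prod[OF sX], folded subset_prod_sum_def]
  note hY = has_sum_infsum[OF summable_on_Fpow_prod[OF sY], folded subset_prod_sum_def]
  note hU = has_sum_infsum[OF summable_on_Fpow_prod[OF assms(1)], folded subset_prod_sum_def]
  have "((\<lambda>(P, Q). prod f P * prod f Q) has_sum subset_prod_sum f (X \<union> Y)) (Fpow X \<times> Fpow Y)
        \<longleftrightarrow> (prod f has_sum subset_prod_sum f (X \<union> Y)) (Fpow (X \<union> Y))"
    by (rule has_sum_reindex_bij_witness
        [where j = "\<lambda>(P, Q). P \<union> Q" and i = "\<lambda>S. (S \<inter> X, S \<inter> Y)"])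
       (use disj in \<open>auto simp: Fpow_def intro!: prod.union_disjoint\<close>)
  with hU have "((\<lambda>(P, Q). prod f P * prod f Q) has_sum subset_prod_sum f (X \<union> Y))
                 (Fpow X \<times> Fpow Y)" by simp
  then have "((\<lambda>P. prod f P * subset_prod_sum f Y) has_sum subset_prod_sum f (X \<union> Y)) (Fpow X)"
    by (rule has_sum_SigmaD) (auto intro: has_sum_cmult_right hY)
  moreover have "((\<lambda>P. prod f P * subset_prod_sum f Y) has_sum
                  subset_prod_sum f X * subset_prod_sum f Y) (Fpow X)"
    by (rule has_sum_cmult_left) (rule hX)
  ultimately show ?thesis by (rule has_sum_unique)
qed

lemma subset_prod_sum_image:
  assumes "inj_on h X"
  shows "subset_prod_sum f (h ` X) = subset_prod_sum (\<lambda>x. f (h x)) X"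
proof -
  have "(\<Sum>\<^sub>\<infinity>S\<in>Fpow (h ` X). prod f S) = (\<Sum>\<^sub>\<infinity>S\<in>(image h) ` Fpow X. prod f S)"
    by (rule arg_cong[where f = "infsum _"])
       (auto simp: Fpow_def image_iff elim: finite_subset_image)
  also have "\<dots> = (\<Sum>\<^sub>\<infinity>S\<in>Fpow X. prod f (h ` S))"
    by (subst infsum_reindex[OF inj_on_image_Fpow[OF assms]]) (simp add: o_def)
  also have "\<dots> = (\<Sum>\<^sub>\<infinity>S\<in>Fpow X. \<Prod>x\<in>S. f (h x))"
    by (intro infsum_cong prod.reindex_cong refl)
       (use assms in \<open>auto simp: Fpow_def intro: inj_on_subset\<close>)
  finally show ?thesis by (simp add: subset_prod_sum_def)
qed

text \<open>An array is encoded by the set of its entries, those of the top row tagged \<open>True\<close> and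
  those of the bottom row tagged \<open>False\<close>; its weight and the difference of its row lengths are then
  sums over this set (\<open>energy\<close> and \<open>charge\<close> below).\<close>

definition sites :: "nat set \<Rightarrow> (bool \<times> entry) set" where
  "sites J = UNIV \<times> UNIV \<times> J"

text \<open>The extra 1 for a top-row entry yields the summand \<open>length (fst p)\<close> of
  \<open>weight\<close>.\<close>

definition site_energy :: "bool \<times> entry \<Rightarrow> nat" where
  "site_energy x = (if fst x then 1 else 0) + fst (snd x)"

definition site_charge :: "bool \<times> entry \<Rightarrow> int" where
  "site_charge x = (if fst x then 1 else - 1)"

definition monomial :: "complex \<Rightarrow> complex \<Rightarrow> bool \<times> entry \<Rightarrow> complex" where
  "monomial q \<zeta> x = q ^ site_energy x * \<zeta> powi site_charge x"

text \<open>For a fixed tag and color the norms form a geometric series in the value, and only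
  finitely many tags and colors occur.\<close>

lemma monomial_abs_summable:
  assumes "norm q < 1" "finite J"
  shows "(\<lambda>x. norm (monomial q \<zeta> x)) summable_on sites J"
proof -
  have eq: "sites J = (\<Union>p\<in>UNIV \<times> J. range (\<lambda>m. (fst p, m, snd p)))"
    by (force simp: sites_def)
  have geo: "(\<lambda>m. norm q ^ m) summable_on UNIV"
    using assms(1) by (intro summable_nonneg_imp_summable_on) (auto intro: summable_geometric)
  have "(\<lambda>x. norm (monomial q \<zeta> x)) summable_on range (\<lambda>m. (fst p, m, snd p))" for p :: "bool \<times> nat"
  proof (subst summable_on_reindex)
    show "((\<lambda>x. norm (monomial q \<zeta> x)) \<circ> (\<lambda>m. (fst p, m, snd p))) summable_on UNIV"
      using summable_on_cmult_right[OF geo, of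
         "norm (q ^ (if fst p then 1 else 0) * \<zeta> powi (if fst p then 1 else - 1))"]
      by (simp add: o_def monomial_def site_energy_def site_charge_def norm_mult norm_power power_add mult_ac)
  qed (auto intro: inj_onI)
  then show ?thesis
    unfolding eq using assms(2)
    by (intro summable_on_finite_union_disjoint) auto
qed

lemma monomial_prod:
  assumes "\<zeta> \<noteq> 0"
  shows "(\<Prod>x\<in>S. monomial q \<zeta> x) = q ^ (\<Sum>x\<in>S. site_energy x) * \<zeta> powi (\<Sum>x\<in>S. site_charge x)"
proof (induction S rule: infinite_finite_induct)
  case (insert x S)
  then show ?case
    using assms by (simp add: monomial_def power_add power_int_add mult_ac)
qed auto

text \<open>\<open>monomial\<close> ignores the color, so each color, split off one at a time,
  contributes the same factor.\<close>

lemma subset_prod_sum_colors: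
  assumes "norm q < 1"
  shows "subset_prod_sum (monomial q \<zeta>) (sites {1..k}) =
         subset_prod_sum (monomial q \<zeta>) (sites {1}) ^ k"
proof (induction k)
  case 0
  have "Fpow ({} :: (bool \<times> entry) set) = {{}}" by (auto simp: Fpow_def)
  then show ?case by (simp add: sites_def subset_prod_sum_def)
next
  case (Suc k)
  define h :: "bool \<times> entry \<Rightarrow> bool \<times> entry" where "h = (\<lambda>(b, m, j). (b, m, Suc k))"
  have h: "inj_on h (sites {1})" "h ` sites {1} = sites {Suc k}"
    by (auto simp: h_def sites_def inj_on_def image_iff)
  have eq: "sites {1..Suc k} = sites {1..k} \<union> sites {Suc k}"
    by (auto simp: sites_def)
  have "subset_prod_sum (monomial q \<zeta>) (sites {Suc k}) =
        subset_prod_sum (\<lambda>x. monomial q \<zeta> (h x)) (sites {1})"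
    using subset_prod_sum_image[OF h(1)] h(2) by simp
  also have "(\<lambda>x. monomial q \<zeta> (h x)) = monomial q \<zeta>"
    by (auto simp: h_def monomial_def site_energy_def site_charge_def fun_eq_iff)
  finally have "subset_prod_sum (monomial q \<zeta>) (sites {Suc k}) =
                subset_prod_sum (monomial q \<zeta>) (sites {1})" .
  moreover have "subset_prod_sum (monomial q \<zeta>) (sites {1..Suc k}) =
      subset_prod_sum (monomial q \<zeta>) (sites {1..k}) * subset_prod_sum (monomial q \<zeta>) (sites {Suc k})"
    unfolding eq
    by (rule subset_prod_sum_Un)
       (use monomial_abs_summable[OF assms, of "{1..Suc k}" \<zeta>] in \<open>simp only: eq finite_atLeastAtMost\<close>,
        auto simp: sites_def)
  ultimately show ?case using Suc by simp
qed

section \<open>Uniqueness of Laurent coefficients\<close>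

lemma has_sum_sum:
  fixes f :: "'i \<Rightarrow> 'a \<Rightarrow> 'b::topological_comm_monoid_add"
  assumes "\<And>i. i \<in> I \<Longrightarrow> (f i has_sum s i) A"
  shows "((\<lambda>x. \<Sum>i\<in>I. f i x) has_sum (\<Sum>i\<in>I. s i)) A"
  using assms by (induction I rule: infinite_finite_induct) (auto intro: has_sum_add)

text \<open>A geometric sum whose ratio \<open>w\<close> is an \<open>N\<close>-th root of unity;
  the ratio is 1 exactly when \<open>N\<close> divides \<open>m\<close>.\<close>

lemma sum_roots_of_unity_powi:
  fixes N :: nat and m :: int
  assumes "N > 0"
  shows "(\<Sum>j<N. cis (2 * pi * real j / real N) powi m) = (if int N dvd m then of_nat N else 0)"
proof -
  define w where "w = cis (2 * pi * m / N)"
  have "cis (2 * pi * real j / real N) powi m = w ^ j" for j :: nat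
    by (simp add: w_def cis_power_int Complex.DeMoivre mult_ac)
  then have S: "(\<Sum>j<N. cis (2 * pi * real j / real N) powi m) = (\<Sum>j<N. w ^ j)" by simp
  have "w = 1 \<longleftrightarrow> int N dvd m"
  proof -
    have "w = 1 \<longleftrightarrow> (\<exists>n::int. 2 * pi * m / real N = of_int (2 * n) * pi)"
      by (simp add: w_def cis_conv_exp exp_eq_1)
    also have "\<dots> \<longleftrightarrow> (\<exists>n::int. m = int N * n)"
      using assms by (intro ex_cong1) (simp add: field_simps, simp flip: of_int_eq_iff[where 'a = real])
    finally show ?thesis by (simp add: dvd_def)
  qed
  moreover have "w ^ N = 1"
    using assms by (simp add: w_def Complex.DeMoivre cis_multiple_2pi)
  ultimately show ?thesis
    unfolding S by (auto simp: geometric_sum)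
qed

text \<open>Averaging over the \<open>N\<close>-th roots of unity isolates the exponents congruent to \<open>m0\<close>
  modulo \<open>N\<close>; by absolute convergence only \<open>m0\<close> survives as \<open>N\<close> grows.\<close>

lemma laurent_coeff_eq_0:
  fixes d :: "int \<Rightarrow> complex"
  assumes "\<And>\<zeta>. norm \<zeta> = 1 \<Longrightarrow> ((\<lambda>m. d m * \<zeta> powi m) has_sum 0) UNIV"
  shows "d m0 = 0"
proof -
  \<comment> \<open>At \<open>\<zeta> = 1\<close> the hypothesis makes \<open>d\<close> itself
    summable, hence absolutely summable.\<close>
  have abs: "(\<lambda>m. norm (d m)) summable_on UNIV"
    using assms[of 1] summable_on_iff_abs_summable_on_complex has_sum_imp_summable by fastforce
  have per: "(d has_sum 0) {m. int N dvd m - m0}" if N: "N > 0" for N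
  proof -
    \<comment> \<open>Dividing by the \<open>m0\<close>-th power of the root moves the exponent
      \<open>m0\<close> to 0.\<close>
    have "((\<lambda>m. d m * cis (2 * pi * real j / real N) powi (m - m0)) has_sum 0) UNIV" for j :: nat
      using has_sum_cmult_left[OF assms[of "cis (2 * pi * real j / real N)"], of "cis (2 * pi * real j / real N) powi (- m0)"]
      by (simp add: power_int_diff power_int_minus field_simps)
    then have "((\<lambda>m. \<Sum>j<N. d m * cis (2 * pi * real j / real N) powi (m - m0)) has_sum (\<Sum>j<N. 0)) UNIV"
      by (intro has_sum_sum) auto
    then have "((\<lambda>m. d m * (if int N dvd m - m0 then of_nat N else 0)) has_sum 0) UNIV"
      by (simp only: sum_distrib_left[symmetric] sum_roots_of_unity_powi[OF N] sum.neutral_const)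
    from has_sum_cmult_left[OF this, of "1 / of_nat N"]
    have "((\<lambda>m. d m * (if int N dvd m - m0 then of_nat N else 0) * (1 / of_nat N)) has_sum 0) UNIV"
      by simp
    also have "(\<lambda>m. d m * (if int N dvd m - m0 then of_nat N else 0) * (1 / of_nat N)) =
               (\<lambda>m. if int N dvd m - m0 then d m else 0)"
      using N by auto
    finally have "((\<lambda>m. if int N dvd m - m0 then d m else 0) has_sum 0) UNIV" .
    then show ?thesis
      by (rule has_sum_cong_neutral[THEN iffD1, rotated -1]) auto
  qed
  have "norm (d m0) \<le> e" if e: "e > 0" for e
  proof -
    obtain F where F: "finite F" "dist (sum (\<lambda>m. norm (d m)) F) (infsum (\<lambda>m. norm (d m)) UNIV) \<le> e"
      using infsum_finite_approximation[OF abs e] by blast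
    \<comment> \<open>\<open>N\<close> exceeds \<open>\<bar>m - m0\<bar>\<close> for all
      \<open>m\<close> in \<open>F\<close>, so every other exponent congruent to \<open>m0\<close>
      lies outside \<open>F\<close>, where the total norm is at most \<open>e\<close>.\<close>
    define N where "N = Suc (\<Sum>m\<in>F. nat \<bar>m - m0\<bar>)"
    have N: "N > 0" by (simp add: N_def)
    have far: "m \<notin> F" if "int N dvd m - m0" "m \<noteq> m0" for m
    proof
      assume "m \<in> F"
      then have "nat \<bar>m - m0\<bar> < N"
        unfolding N_def less_Suc_eq_le using F(1)
        by (intro member_le_sum[where f = "\<lambda>m. nat \<bar>m - m0\<bar>"]) auto
      with that show False using zdvd_imp_le[of "int N" "\<bar>m - m0\<bar>"] by auto
    qed
    let ?M = "{m. int N dvd m - m0} - {m0}"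
    have split: "{m. int N dvd m - m0} = insert m0 ?M" by auto
    have sM: "(\<lambda>m. norm (d m)) summable_on ?M" "d summable_on ?M"
      using abs by (auto intro: summable_on_subset_banach abs_summable_summable)
    have "0 = d m0 + infsum d ?M"
      using per[OF N] sM(2) split by (metis (no_types, lifting) Diff_iff has_sum_iff infsum_insert singletonI)
    then have "norm (d m0) = norm (infsum d ?M)"
      by (metis add.inverse_unique norm_minus_cancel)
    also have "\<dots> \<le> infsum (\<lambda>m. norm (d m)) ?M"
      using norm_infsum_bound[OF sM(1)] .
    also have "\<dots> \<le> infsum (\<lambda>m. norm (d m)) (UNIV - F)"
      using far by (intro infsum_mono2 sM summable_on_subset_banach[OF abs]) auto
    also have "\<dots> = infsum (\<lambda>m. norm (d m)) UNIV - sum (\<lambda>m. norm (d m)) F"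
      using F(1) abs by (subst Infinite_Sum.infsum_Diff) auto
    also have "\<dots> \<le> e" using F(2) by (simp add: dist_real_def)
    finally show ?thesis .
  qed
  then show ?thesis
    by (metis dense norm_eq_zero norm_ge_zero not_le order_less_le)
qed

section \<open>The Jacobi triple product\<close>

text \<open>The Gaussian binomial coefficient, defined by the \<open>q\<close>-Pascal rule so that
  no denominators occur.\<close>

fun qbinomial :: "complex \<Rightarrow> nat \<Rightarrow> nat \<Rightarrow> complex" where
  "qbinomial q n 0 = 1"
| "qbinomial q 0 (Suc j) = 0"
| "qbinomial q (Suc n) (Suc j) = qbinomial q n j + q ^ Suc j * qbinomial q n (Suc j)"

text \<open>The \<open>q\<close>-Pochhammer product \<open>(q; q)_n\<close>, without the division by
  \<open>(1 - q)^n\<close> of the usual \<open>q\<close>-factorial.\<close>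

definition qfact :: "complex \<Rightarrow> nat \<Rightarrow> complex" where
  "qfact q n = (\<Prod>i<n. 1 - q ^ Suc i)"

lemma qbinomial_eq_0: "n < j \<Longrightarrow> qbinomial q n j = 0"
  by (induction q n j rule: qbinomial.induct) auto

lemma qbinomial_self: "qbinomial q n n = 1"
  by (induction n) (auto simp: qbinomial_eq_0)

text \<open>Induction along the \<open>q\<close>-Pascal rule; for \<open>n = j + d + 1\<close> the
  step rests on \<open>(1 - q^(j+1)) + q^(j+1) (1 - q^(d+1)) = 1 - q^(n+1)\<close>.\<close>

lemma qbinomial_qfact:
  "j \<le> n \<Longrightarrow> qbinomial q n j * qfact q j * qfact q (n - j) = qfact q n"
proof (induction q n j rule: qbinomial.induct)
  case (3 q n j)
  show ?case
  proof (cases "j = n")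
    case True
    then show ?thesis by (simp only: diff_self_eq_0 qbinomial_self) (simp add: qfact_def)
  next
    case False
    with 3 have jn: "j < n" by simp
    then obtain d where d: "n = Suc (j + d)" by (metis less_iff_Suc_add)
    have S: "qfact q (Suc i) = qfact q i * (1 - q ^ Suc i)" for i by (simp add: qfact_def)
    have e: "n - j = Suc d" "n - Suc j = d" "Suc n - Suc j = Suc d" using d by auto
    have 1: "qbinomial q n j * qfact q j * (qfact q d * (1 - q ^ Suc d)) = qfact q n"
      using 3(1) jn by (simp only: e S)
    have 2: "qbinomial q n (Suc j) * (qfact q j * (1 - q ^ Suc j)) * qfact q d = qfact q n"
      using 3(2) jn by (simp only: e S)
    have "qbinomial q (Suc n) (Suc j) * qfact q (Suc j) * qfact q (Suc n - Suc j) =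
          (1 - q ^ Suc j) * (qbinomial q n j * qfact q j * (qfact q d * (1 - q ^ Suc d))) +
          q ^ Suc j * (1 - q ^ Suc d) *
            (qbinomial q n (Suc j) * (qfact q j * (1 - q ^ Suc j)) * qfact q d)"
      unfolding e S qbinomial.simps by (simp only: algebra_simps)
    also have "\<dots> = qfact q n * (1 - q ^ Suc j * q ^ Suc d)"
      unfolding 1 2 by (simp add: algebra_simps del: power_Suc)
    also have "q ^ Suc j * q ^ Suc d = q ^ Suc n"
      using d by (simp flip: power_add)
    finally show ?thesis unfolding S .
  qed
qed (auto simp: qfact_def)

lemma qbinomial_theorem:
  "(\<Prod>i<n. 1 + x * q ^ i) = (\<Sum>j\<le>n. q ^ (j choose 2) * qbinomial q n j * x ^ j)"
proof (induction n arbitrary: x)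
  case (Suc n)
  let ?e = "\<lambda>n j. q ^ (j choose 2) * qbinomial q n j"
  have C: "Suc j choose 2 = (j choose 2) + j" for j
    by (simp add: numeral_2_eq_2)
  \<comment> \<open>Splitting off the factor \<open>i = 0\<close> leaves the same product at
    \<open>x * q\<close>, to which the induction hypothesis applies.\<close>
  have "(\<Prod>i<Suc n. 1 + x * q ^ i) = (1 + x) * (\<Prod>i<n. 1 + (x * q) * q ^ i)"
    by (simp add: prod.lessThan_Suc_shift mult_ac del: prod.lessThan_Suc)
  also have "\<dots> = (1 + x) * (\<Sum>j\<le>n. ?e n j * (x * q) ^ j)"
    by (simp only: Suc)
  \<comment> \<open>The summand \<open>j = Suc n\<close> added here is 0, because
    \<open>qbinomial q n (Suc n)\<close> vanishes.\<close>
  also have "\<dots> = (\<Sum>j\<le>Suc n. ?e n j * (x * q) ^ j) + (\<Sum>j\<le>n. x * (?e n j * (x * q) ^ j))"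
    by (simp add: qbinomial_eq_0 algebra_simps sum_distrib_left sum.distrib)
  also have "\<dots> = 1 + (\<Sum>j\<le>n. ?e n (Suc j) * (x * q) ^ Suc j + x * (?e n j * (x * q) ^ j))"
    by (simp add: sum.atMost_Suc_shift sum.distrib binomial_eq_0 del: sum.atMost_Suc power_Suc)
  \<comment> \<open>After \<open>q ^ (Suc j choose 2)\<close> is taken out, this is the
    \<open>q\<close>-Pascal rule.\<close>
  also have "\<dots> = 1 + (\<Sum>j\<le>n. ?e (Suc n) (Suc j) * x ^ Suc j)"
    by (intro arg_cong2[where f = "(+)"] sum.cong refl)
       (simp add: C power_add power_mult_distrib algebra_simps)
  also have "\<dots> = (\<Sum>j\<le>Suc n. ?e (Suc n) j * x ^ j)"
    by (simp add: sum.atMost_Suc_shift binomial_eq_0 del: sum.atMost_Suc power_Suc)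
  finally show ?case .
qed (simp add: binomial_eq_0)

text \<open>For \<open>n = m + 1/2\<close> the exponent \<open>n^2 / 2\<close> of \<open>q\<close>
  in the theta series is \<open>theta_exponent m + 1/8\<close>. The division is exact, as
  \<open>m * (m + 1)\<close> is even.\<close>

definition theta_exponent :: "int \<Rightarrow> int" where
  "theta_exponent m = m * (m + 1) div 2"

lemma two_theta_exponent: "2 * theta_exponent m = m * (m + 1)"
  by (simp add: theta_exponent_def)

lemma two_choose_two: "2 * int (n choose 2) = int n * (int n - 1)"
proof (induction n)
  case (Suc n)
  then show ?case by (simp add: numeral_2_eq_2 algebra_simps)
qed (simp add: binomial_eq_0)

text \<open>This is the \<open>q\<close>-binomial theorem for \<open>n = 2 N\<close> at \<open>x = \<zeta> q\<^bsup>1 - N\<^esup>\<close>.\<close>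

lemma finite_triple_product:
  assumes "q \<noteq> 0" "\<zeta> \<noteq> 0"
  shows "(\<Prod>i<N. 1 + \<zeta> * q ^ Suc i) * (\<Prod>i<N. 1 + q ^ i / \<zeta>) =
         (\<Sum>j\<le>2 * N. q powi theta_exponent (int j - int N) * qbinomial q (2 * N) j
                          * \<zeta> powi (int j - int N))"
proof -
  define x where "x = \<zeta> * q powi (1 - int N)"
  \<comment> \<open>The factors with index at least \<open>N\<close> give the first product; those
    below \<open>N\<close>, read backwards, give the second up to the factors
    \<open>\<zeta> / q ^ i\<close>.\<close>
  have hi: "x * q ^ (i + N) = \<zeta> * q ^ Suc i" for i
    using assms by (simp add: x_def power_int_diff power_int_add power_add field_simps)
  have lo: "1 + x * q ^ (N - Suc i) = \<zeta> / q ^ i * (1 + q ^ i / \<zeta>)" if "i < N" for i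
  proof -
    have "x * q ^ (N - Suc i) = \<zeta> * q powi (1 - int N + int (N - Suc i))"
      using assms by (simp add: x_def power_int_add)
    also have "1 - int N + int (N - Suc i) = - int i" using that by simp
    finally show ?thesis using assms by (simp add: power_int_minus field_simps)
  qed
  have "(\<Prod>i<2 * N. 1 + x * q ^ i) = (\<Prod>i<N. 1 + x * q ^ i) * (\<Prod>i<N. 1 + x * q ^ (i + N))"
    using prod.atLeastLessThan_concat[of 0 N "2 * N" "\<lambda>i. 1 + x * q ^ i"]
      prod.shift_bounds_nat_ivl[of "\<lambda>i. 1 + x * q ^ i" 0 N N]
    by (simp add: atLeast0LessThan mult_2)
  also have "(\<Prod>i<N. 1 + x * q ^ i) = (\<Prod>i<N. 1 + x * q ^ (N - Suc i))"
    by (rule prod.nat_diff_reindex[symmetric])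
  also have "\<dots> = (\<Prod>i<N. \<zeta> / q ^ i) * (\<Prod>i<N. 1 + q ^ i / \<zeta>)"
    by (simp flip: prod.distrib add: lo)
  also have "(\<Prod>i<N. \<zeta> / q ^ i) = \<zeta> ^ N / q ^ (N choose 2)"
    by (induction N) (auto simp: numeral_2_eq_2 power_add mult_ac)
  finally have "(\<Prod>i<N. 1 + \<zeta> * q ^ Suc i) * (\<Prod>i<N. 1 + q ^ i / \<zeta>) =
                q ^ (N choose 2) / \<zeta> ^ N * (\<Prod>i<2 * N. 1 + x * q ^ i)"
    using assms unfolding hi by (simp add: field_simps)
  also have "\<dots> = (\<Sum>j\<le>2 * N. q ^ (N choose 2) / \<zeta> ^ N *
                          (q ^ (j choose 2) * qbinomial q (2 * N) j * x ^ j))"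
    unfolding qbinomial_theorem sum_distrib_left ..
  also have "\<dots> = (\<Sum>j\<le>2 * N. q powi theta_exponent (int j - int N) * qbinomial q (2 * N) j
                          * \<zeta> powi (int j - int N))"
  proof (rule sum.cong[OF refl])
    fix j
    \<comment> \<open>Doubling turns both kinds of halves into integer polynomials.\<close>
    have "2 * theta_exponent (int j - int N) =
          2 * (int (N choose 2) + int (j choose 2) + (1 - int N) * int j)"
      unfolding distrib_left two_theta_exponent two_choose_two by (simp add: algebra_simps)
    then have T: "theta_exponent (int j - int N) = int (N choose 2) + int (j choose 2) + (1 - int N) * int j"
      by simp
    have xj: "x ^ j = \<zeta> ^ j * q powi ((1 - int N) * int j)"
      by (simp add: x_def power_mult_distrib power_int_mult)
    show "q ^ (N choose 2) / \<zeta> ^ N * (q ^ (j choose 2) * qbinomial q (2 * N) j * x ^ j) =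
          q powi theta_exponent (int j - int N) * qbinomial q (2 * N) j * \<zeta> powi (int j - int N)"
      unfolding T xj using assms by (simp add: power_int_add power_int_diff field_simps)
  qed
  finally show ?thesis .
qed

section \<open>Coefficients of fixed charge\<close>

definition energy :: "(bool \<times> entry) set \<Rightarrow> nat" where
  "energy S = (\<Sum>x\<in>S. site_energy x)"

definition charge :: "(bool \<times> entry) set \<Rightarrow> int" where
  "charge S = (\<Sum>x\<in>S. site_charge x)"

text \<open>The coefficient of \<open>\<zeta> powi m\<close> in
  \<open>subset_prod_sum (monomial q \<zeta>) (sites J)\<close>.\<close>

definition charge_coeff :: "complex \<Rightarrow> nat set \<Rightarrow> int \<Rightarrow> complex" where
  "charge_coeff q J m = (\<Sum>\<^sub>\<infinity>S\<in>{S \<in> Fpow (sites J). charge S = m}. q ^ energy S)"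

text \<open>Used with \<open>charge\<close> to collect powers of \<open>\<zeta>\<close> and with
  \<open>energy\<close> to collect powers of \<open>q\<close>.\<close>

lemma has_sum_fibers:
  fixes f :: "'a \<Rightarrow> 'b::banach"
  assumes "(f has_sum s) A"
  shows "((\<lambda>y. \<Sum>\<^sub>\<infinity>x\<in>{x \<in> A. h x = y}. f x) has_sum s) UNIV"
proof -
  have "((\<lambda>(y, x). f x) has_sum s) (SIGMA y:UNIV. {x \<in> A. h x = y}) \<longleftrightarrow> (f has_sum s) A"
    by (rule has_sum_reindex_bij_witness[where j = snd and i = "\<lambda>x. (h x, x)"]) auto
  with assms have "((\<lambda>(y, x). f x) has_sum s) (SIGMA y:UNIV. {x \<in> A. h x = y})" by simp
  then show ?thesis
  proof (rule has_sum_SigmaD)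
    fix y
    have "f summable_on {x \<in> A. h x = y}"
      using has_sum_imp_summable[OF assms] by (rule summable_on_subset_banach) auto
    then show "((\<lambda>x. case (y, x) of (y, x) \<Rightarrow> f x) has_sum (\<Sum>\<^sub>\<infinity>x\<in>{x \<in> A. h x = y}. f x))
                 {x \<in> A. h x = y}" by simp
  qed
qed

text \<open>The family \<open>\<S>\<close> is left arbitrary to serve both finite boxes and all of
  \<open>Fpow (sites J)\<close>.\<close>

lemma charge_expansion:
  assumes "\<zeta> \<noteq> 0" and "((\<lambda>S. \<Prod>x\<in>S. monomial q \<zeta> x) has_sum s) \<S>"
  shows "((\<lambda>m. (\<Sum>\<^sub>\<infinity>S\<in>{S \<in> \<S>. charge S = m}. q ^ energy S) * \<zeta> powi m) has_sum s) UNIV"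
proof -
  have "(\<Sum>\<^sub>\<infinity>S\<in>{S \<in> \<S>. charge S = m}. \<Prod>x\<in>S. monomial q \<zeta> x) =
        (\<Sum>\<^sub>\<infinity>S\<in>{S \<in> \<S>. charge S = m}. q ^ energy S) * \<zeta> powi m" for m
    unfolding infsum_cmult_left'[symmetric]
    by (intro infsum_cong) (auto simp: monomial_prod[OF assms(1)] energy_def charge_def)
  then show ?thesis using has_sum_fibers[OF assms(2), of charge] by simp
qed

lemma prod_box:
  "(\<Prod>x\<in>UNIV \<times> {..<N} \<times> {1}. 1 + monomial q \<zeta> x) =
   (\<Prod>i<N. 1 + \<zeta> * q ^ Suc i) * (\<Prod>i<N. 1 + q ^ i / \<zeta>)"
proof -
  have "(\<Prod>x\<in>UNIV \<times> {..<N} \<times> {1}. 1 + monomial q \<zeta> x) =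
        (\<Prod>b\<in>UNIV. \<Prod>i<N. \<Prod>j\<in>{1}. 1 + monomial q \<zeta> (b, i, j))"
    by (simp only: prod.cartesian_product case_prod_eta split_def prod.collapse)
  then show ?thesis
    by (simp add: UNIV_bool monomial_def site_energy_def site_charge_def power_int_minus field_simps)
qed

text \<open>Expanding one finite product over subsets and by \<open>finite_triple_product\<close>
  gives two Laurent expansions that agree on the unit circle, hence have equal coefficients.\<close>

lemma box_coeff:
  assumes "q \<noteq> 0"
  shows "(\<Sum>S\<in>{S \<in> Pow (UNIV \<times> {..<N} \<times> {1}). charge S = m}. q ^ energy S) =
         (if \<bar>m\<bar> \<le> int N then q powi theta_exponent m * qbinomial q (2 * N) (nat (m + int N)) else 0)"
proof -
  let ?B = "UNIV \<times> {..<N} \<times> {1} :: (bool \<times> entry) set"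
  define a where "a m = (\<Sum>\<^sub>\<infinity>S\<in>{S \<in> Pow ?B. charge S = m}. q ^ energy S)" for m
  define b where "b m = (if \<bar>m\<bar> \<le> int N
      then q powi theta_exponent m * qbinomial q (2 * N) (nat (m + int N)) else 0)" for m
  have "a m - b m = 0"
  proof (rule laurent_coeff_eq_0)
    fix \<zeta> :: complex assume "norm \<zeta> = 1"
    then have \<zeta>: "\<zeta> \<noteq> 0" by auto
    let ?G = "(\<Prod>i<N. 1 + \<zeta> * q ^ Suc i) * (\<Prod>i<N. 1 + q ^ i / \<zeta>)"
    have "((\<lambda>S. \<Prod>x\<in>S. monomial q \<zeta> x) has_sum ?G) (Pow ?B)"
      by (rule has_sum_finiteI) (simp_all only: sum_Pow_prod finite_SigmaI finite finite_lessThan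
          finite_Pow_iff finite.intros prod_box)
    from charge_expansion[OF \<zeta> this] have 1: "((\<lambda>m. a m * \<zeta> powi m) has_sum ?G) UNIV"
      by (simp only: a_def)
    have "?G = (\<Sum>m\<in>{- int N..int N}. b m * \<zeta> powi m)"
      unfolding finite_triple_product[OF assms \<zeta>]
      by (rule sum.reindex_bij_witness[where i = "\<lambda>m. nat (m + int N)" and j = "\<lambda>j. int j - int N"])
         (auto simp: b_def)
    then have "((\<lambda>m. b m * \<zeta> powi m) has_sum ?G) UNIV"
      by (intro has_sum_finite_neutralI[where B = "{- int N..int N}"]) (auto simp: b_def)
    from has_sum_add[OF 1 has_sum_uminusI[OF this]] show "((\<lambda>m. (a m - b m) * \<zeta> powi m) has_sum 0) UNIV"
      by (simp add: algebra_simps)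
  qed
  then show ?thesis by (simp add: a_def b_def)
qed

lemma energy_power_summable:
  fixes q :: complex
  assumes "norm q < 1" "finite J"
  shows "(\<lambda>S. q ^ energy S) summable_on {S \<in> Fpow (sites J). charge S = m}"
proof (rule summable_on_subset_banach)
  \<comment> \<open>At \<open>\<zeta> = 1\<close> the product of the monomials over \<open>S\<close>
    is \<open>q ^ energy S\<close>.\<close>
  show "(\<lambda>S. q ^ energy S) summable_on Fpow (sites J)"
    using summable_on_Fpow_prod[OF monomial_abs_summable[OF assms, of 1]]
    by (simp add: monomial_prod energy_def)
qed auto

section \<open>The Euler product and the limit of the finite boxes\<close>

lemma convergent_prod_euler:
  fixes q :: complex
  assumes "norm q < 1"
  shows "convergent_prod (\<lambda>n. 1 - q ^ Suc n)"
proof (intro abs_convergent_prod_imp_convergent_prod summable_imp_abs_convergent_prod)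
  show "summable (\<lambda>n. norm (1 - q ^ Suc n - 1))"
    using assms summable_mult[OF summable_geometric[of "norm q"], of "norm q"]
    by (simp add: norm_mult norm_power)
qed

lemma euler_factor_nonzero:
  fixes q :: complex
  assumes "norm q < 1"
  shows "1 - q ^ Suc n \<noteq> 0"
proof
  assume "1 - q ^ Suc n = 0"
  then have "norm q ^ Suc n = 1" by (metis eq_iff_diff_eq_0 norm_one norm_power)
  with assms show False
    using mult_left_le[of "norm q ^ n" "norm q"] power_le_one[of "norm q" n] by auto
qed

lemma euler_nonzero:
  fixes q :: complex
  assumes "norm q < 1"
  shows "(\<Prod>n. 1 - q ^ Suc n) \<noteq> 0"
  by (rule prodinf_nonzero[OF convergent_prod_euler[OF assms]]) (rule euler_factor_nonzero[OF assms])

lemma qfact_LIMSEQ: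
  assumes "norm q < 1"
  shows "qfact q \<longlonglongrightarrow> (\<Prod>n. 1 - q ^ Suc n)"
proof -
  \<comment> \<open>The partial products of \<open>prodinf\<close> run over \<open>{..n}\<close>,
    hence the shift by one.\<close>
  have "(\<lambda>n. qfact q (Suc n)) \<longlonglongrightarrow> (\<Prod>n. 1 - q ^ Suc n)"
    using convergent_prod_LIMSEQ[OF convergent_prod_euler[OF assms]]
    by (simp add: qfact_def lessThan_Suc_atMost del: prod.lessThan_Suc)
  then show ?thesis by (simp only: filterlim_sequentially_Suc)
qed

text \<open>The coefficient is the limit of those in \<open>box_coeff\<close>, where the Gaussian
  binomial tends to \<open>P / (P * P)\<close> for the Euler product \<open>P\<close>.\<close>

lemma charge_coeff_single:
  assumes "norm q < 1" "q \<noteq> 0"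
  shows "charge_coeff q {1} m = q powi theta_exponent m / (\<Prod>n. 1 - q ^ Suc n)"
proof -
  define P where "P = (\<Prod>n. 1 - q ^ Suc n)"
  have P: "P \<noteq> 0" unfolding P_def by (rule euler_nonzero) fact
  let ?A = "{S \<in> Fpow (sites {1}). charge S = m}"
  define box where "box N = {S \<in> Pow (UNIV \<times> {..<N} \<times> {1}). charge S = m}" for N :: nat
  \<comment> \<open>Finitely many finite sets of sites fit into one box, so the infinite sum may be
    computed along the boxes.\<close>
  have "filterlim box (finite_subsets_at_top ?A) sequentially"
    unfolding filterlim_finite_subsets_at_top
  proof (intro allI impI)
    fix X assume X: "finite X \<and> X \<subseteq> ?A"
    then have "finite ((\<lambda>x. fst (snd x)) ` \<Union>X)"
      by (auto simp: Fpow_def)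
    then obtain M where M: "\<And>x. x \<in> \<Union>X \<Longrightarrow> fst (snd x) < M"
      unfolding finite_nat_set_iff_bounded by blast
    show "\<forall>\<^sub>F N in sequentially. finite (box N) \<and> X \<subseteq> box N \<and> box N \<subseteq> ?A"
      using eventually_ge_at_top[of M]
    proof eventually_elim
      case (elim N)
      have "x \<in> UNIV \<times> {..<N} \<times> {1}" if "S \<in> X" "x \<in> S" for x S
        using that X M[of x] elim by (force simp: Fpow_def sites_def)
      then have "X \<subseteq> box N" using X by (auto simp: box_def)
      moreover have "box N \<subseteq> ?A"
        by (auto simp: box_def Fpow_def sites_def elim: finite_subset)
      ultimately show ?case by (auto simp: box_def)
    qed
  qed
  moreover have "(sum (\<lambda>S. q ^ energy S) \<longlongrightarrow> charge_coeff q {1} m) (finite_subsets_at_top ?A)"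
    using has_sum_infsum[OF energy_power_summable[OF assms(1), of "{1}" m]]
    by (simp add: has_sum_def charge_coeff_def)
  ultimately have "(\<lambda>N. \<Sum>S\<in>box N. q ^ energy S) \<longlonglongrightarrow> charge_coeff q {1} m"
    by (rule filterlim_compose[rotated])
  moreover have "(\<lambda>N. \<Sum>S\<in>box N. q ^ energy S) \<longlonglongrightarrow> q powi theta_exponent m / P"
  proof -
    \<comment> \<open>One criterion for the three indices below: each is at least
      \<open>N - \<bar>m\<bar>\<close>.\<close>
    have "filterlim f at_top sequentially" if "\<And>N. N \<le> f N + nat \<bar>m\<bar>" for f :: "nat \<Rightarrow> nat"
      unfolding filterlim_at_top eventually_sequentially
    proof (intro allI exI impI)
      fix Z N assume "Z + nat \<bar>m\<bar> \<le> N"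
      then show "Z \<le> f N" using that[of N] by linarith
    qed
    then have "filterlim (\<lambda>N. 2 * N) at_top sequentially"
      "filterlim (\<lambda>N. nat (m + int N)) at_top sequentially"
      "filterlim (\<lambda>N. nat (int N - m)) at_top sequentially"
      by (simp_all add: nat_le_iff)
    note lim = this[THEN filterlim_compose[OF qfact_LIMSEQ[OF assms(1), folded P_def]]]
    have "(\<lambda>N. q powi theta_exponent m * (qfact q (2 * N) / (qfact q (nat (m + int N)) * qfact q (nat (int N - m)))))
          \<longlonglongrightarrow> q powi theta_exponent m * (P / (P * P))"
      using P by (intro tendsto_mult tendsto_divide tendsto_const lim) auto
    moreover have "\<forall>\<^sub>F N in sequentially.
        q powi theta_exponent m * (qfact q (2 * N) / (qfact q (nat (m + int N)) * qfact q (nat (int N - m))))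
        = (\<Sum>S\<in>box N. q ^ energy S)"
      using eventually_ge_at_top[of "nat \<bar>m\<bar>"]
    proof eventually_elim
      case (elim N)
      have nz: "qfact q n \<noteq> 0" for n
        using euler_factor_nonzero[OF assms(1)] by (simp add: qfact_def)
      have d: "2 * N - nat (m + int N) = nat (int N - m)" using elim by linarith
      have "qbinomial q (2 * N) (nat (m + int N)) * qfact q (nat (m + int N)) * qfact q (nat (int N - m))
            = qfact q (2 * N)"
        using qbinomial_qfact[of "nat (m + int N)" "2 * N" q] elim unfolding d by linarith
      then have "qbinomial q (2 * N) (nat (m + int N)) =
          qfact q (2 * N) / (qfact q (nat (m + int N)) * qfact q (nat (int N - m)))"
        using nz by (simp add: field_simps)
      moreover have "\<bar>m\<bar> \<le> int N" using elim by linarith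
      ultimately show ?case unfolding box_def box_coeff[OF assms(2)] by simp
    qed
    ultimately show ?thesis using P by (auto elim: Lim_transform_eventually)
  qed
  ultimately show ?thesis unfolding P_def by (rule LIMSEQ_unique)
qed

section \<open>Rows as finite sets\<close>

definition row_set :: "entry list \<times> entry list \<Rightarrow> (bool \<times> entry) set" where
  "row_set p = Pair True ` set (fst p) \<union> Pair False ` set (snd p)"

lemma is_row_Cons:
  "is_row k (x # xs) \<longleftrightarrow> snd x \<in> {1..k} \<and> (\<forall>y\<in>set xs. entry_less y x) \<and> is_row k xs"
  by (auto simp: is_row_def)

text \<open>The head is the largest element of the set, so equal sets force equal heads; by
  distinctness the tails then have equal sets too.\<close>

lemma is_row_unique:
  assumes "is_row k xs" "is_row k ys" "set xs = set ys"
  shows "xs = ys"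
  using assms
proof (induction xs arbitrary: ys)
  case (Cons x xs)
  then obtain y ys' where ys: "ys = y # ys'" by (cases ys) auto
  have asym: False if "entry_less u v" "entry_less v u" for u v
    using that by (auto simp: entry_less_def)
  have "x = y"
  proof (rule ccontr)
    assume "x \<noteq> y"
    with Cons.prems ys have "x \<in> set ys'" "y \<in> set xs" by auto
    then have "entry_less x y" "entry_less y x"
      using Cons.prems(1,2) ys by (auto simp: is_row_Cons)
    then show False by (rule asym)
  qed
  moreover have "x \<notin> set xs" "y \<notin> set ys'"
    using is_row_distinct[OF Cons.prems(1)] is_row_distinct[OF Cons.prems(2)] ys by auto
  with Cons.prems(3) ys \<open>x = y\<close> have "set xs = set ys'" by (simp add: insert_ident)
  ultimately show ?case using Cons.prems Cons.IH[of ys'] ys by (auto simp: is_row_Cons)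
qed auto

text \<open>Induction on the cardinality, removing the lexicographically largest entry: the largest
  color among the entries of largest value.\<close>

lemma is_row_exists:
  assumes "finite A" "snd ` A \<subseteq> {1..k}"
  shows "\<exists>xs. is_row k xs \<and> set xs = A"
  using assms
proof (induction "card A" arbitrary: A)
  case 0
  then show ?case by (intro exI[of _ "[]"]) (auto simp: is_row_def)
next
  case (Suc n)
  then have ne: "A \<noteq> {}" by auto
  define m where "m = Max (fst ` A)"
  have m: "m \<in> fst ` A" "\<And>x. x \<in> A \<Longrightarrow> fst x \<le> m"
    using Suc.prems ne by (auto simp: m_def)
  define J where "J = {j. (m, j) \<in> A}"
  have J: "finite J" "J \<noteq> {}"
    using m(1) finite_subset[of J "snd ` A"] Suc.prems(1) by (force simp: J_def)+
  define x where "x = (m, Max J)"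
  have "x \<in> A" using Max_in[OF J] by (simp add: x_def J_def)
  have less: "entry_less y x" if "y \<in> A - {x}" for y
  proof (cases "fst y = m")
    case True
    then have "snd y \<in> J" using that by (cases y) (auto simp: J_def)
    then have "snd y \<le> Max J" using J by simp
    then show ?thesis using that True by (cases y) (auto simp: entry_less_def x_def)
  next
    case False
    with m(2)[of y] that show ?thesis by (auto simp: entry_less_def x_def)
  qed
  have "n = card (A - {x})" "finite (A - {x})" "snd ` (A - {x}) \<subseteq> {1..k}"
    using Suc.hyps(2) Suc.prems \<open>x \<in> A\<close> by (simp_all, blast)
  then obtain xs where "is_row k xs" "set xs = A - {x}"
    using Suc.hyps(1) by blast
  then show ?case
    using less \<open>x \<in> A\<close> Suc.prems by (intro exI[of _ "x # xs"]) (auto simp: is_row_Cons)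
qed

text \<open>Rows are free of repetitions and the tags keep the two rows apart, so passing to sets
  loses no multiplicity.\<close>

lemma row_set_stats:
  assumes "is_row k as" "is_row k bs"
  shows "energy (row_set (as, bs)) = weight (as, bs)"
    and "charge (row_set (as, bs)) = int (length as) - int (length bs)"
proof -
  have d: "distinct as" "distinct bs" using assms by (auto intro: is_row_distinct)
  have inj: "inj_on (Pair b) A" for b :: bool and A :: "entry set" by (auto intro: inj_onI)
  have split: "(\<Sum>x\<in>row_set (as, bs). f x) =
      (\<Sum>x\<in>set as. f (True, x)) + (\<Sum>x\<in>set bs. f (False, x))" for f :: "bool \<times> entry \<Rightarrow> 'a::comm_monoid_add"
    unfolding row_set_def by (subst sum.union_disjoint) (auto simp: sum.reindex inj)
  show "energy (row_set (as, bs)) = weight (as, bs)"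
    unfolding energy_def split weight_def using d
    by (simp add: site_energy_def sum_Suc sum_list_distinct_conv_sum_set distinct_card)
  show "charge (row_set (as, bs)) = int (length as) - int (length bs)"
    unfolding charge_def split using d by (simp add: site_charge_def distinct_card)
qed

text \<open>The tags split a finite set of sites into two sets of entries, each of which is the
  entry set of exactly one row.\<close>

lemma bij_betw_row_set:
  "bij_betw row_set {(as, bs). is_row k as \<and> is_row k bs} (Fpow (sites {1..k}))"
proof (rule bij_betw_imageI)
  have sets: "set (fst p) = {x. (True, x) \<in> row_set p}" "set (snd p) = {x. (False, x) \<in> row_set p}" for p
    by (auto simp: row_set_def)
  show "inj_on row_set {(as, bs). is_row k as \<and> is_row k bs}"
  proof (rule inj_onI)
    fix p p' assume "p \<in> {(as, bs). is_row k as \<and> is_row k bs}"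
      "p' \<in> {(as, bs). is_row k as \<and> is_row k bs}" and eq: "row_set p = row_set p'"
    moreover have "set (fst p) = set (fst p')" "set (snd p) = set (snd p')"
      unfolding sets eq by simp_all
    ultimately show "p = p'" by (auto intro: is_row_unique)
  qed
  show "row_set ` {(as, bs). is_row k as \<and> is_row k bs} = Fpow (sites {1..k})"
  proof (intro equalityI subsetI)
    fix S assume "S \<in> row_set ` {(as, bs). is_row k as \<and> is_row k bs}"
    then obtain as bs where S: "S = row_set (as, bs)" and "is_row k as" "is_row k bs" by auto
    then have "snd x \<in> {1..k}" if "x \<in> set as \<union> set bs" for x
      using that by (auto simp: is_row_def)
    then show "S \<in> Fpow (sites {1..k})"
      unfolding S by (force simp: Fpow_def row_set_def sites_def)
  next
    fix S assume S: "S \<in> Fpow (sites {1..k})"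
    define A where "A b = {x. (b, x) \<in> S}" for b
    have A: "finite (A b)" "snd ` A b \<subseteq> {1..k}" for b
      using S finite_subset[of "A b" "snd ` S"] by (force simp: A_def Fpow_def sites_def)+
    obtain as where as: "is_row k as" "set as = A True" using is_row_exists[OF A] by blast
    obtain bs where bs: "is_row k bs" "set bs = A False" using is_row_exists[OF A] by blast
    have "S = row_set (as, bs)"
    proof (rule set_eqI)
      fix p show "p \<in> S \<longleftrightarrow> p \<in> row_set (as, bs)"
        by (cases p; cases "fst p") (auto simp: row_set_def as bs A_def)
    qed
    with as bs show "S \<in> row_set ` {(as, bs). is_row k as \<and> is_row k bs}" by auto
  qed
qed

section \<open>Counting arrays by charge and weight\<close>

lemma c_psi_eq_card:
  "c_psi k (real_of_int m + real k / 2) n =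
   card {S \<in> Fpow (sites {1..k}). charge S = m \<and> energy S = n}"
proof -
  let ?R = "{(as, bs). is_row k as \<and> is_row k bs}"
  let ?P = "{p \<in> F_partitions k (real_of_int m + real k / 2). weight p = n}"
  have stats: "charge (row_set p) = int (length (fst p)) - int (length (snd p))"
    "energy (row_set p) = weight p" if "p \<in> ?R" for p
    using that row_set_stats[of k "fst p" "snd p"] by auto
  \<comment> \<open>The shift by \<open>real k / 2\<close> cancels in the length condition, leaving
    the integer \<open>m\<close>.\<close>
  have P: "?P = {p \<in> ?R. charge (row_set p) = m \<and> energy (row_set p) = n}"
    using stats by (auto simp: F_partitions_def)
  have "inj_on row_set ?P"
    using bij_betw_row_set[of k] P by (auto simp: bij_betw_def intro: inj_on_subset)
  then have "c_psi k (real_of_int m + real k / 2) n = card (row_set ` ?P)"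
    by (simp add: c_psi_def card_image)
  also have "row_set ` ?P = {S \<in> row_set ` ?R. charge S = m \<and> energy S = n}"
    unfolding P by blast
  also have "row_set ` ?R = Fpow (sites {1..k})"
    using bij_betw_row_set by (simp add: bij_betw_def)
  finally show ?thesis .
qed

lemma finite_charge_energy: "finite {S \<in> Fpow (sites {1..k}). charge S = m \<and> energy S = n}"
proof -
  have "{S \<in> Fpow (sites {1..k}). charge S = m \<and> energy S = n} \<subseteq>
        row_set ` {p. is_row k (fst p) \<and> is_row k (snd p) \<and> weight p = n}"
  proof
    fix S assume S: "S \<in> {S \<in> Fpow (sites {1..k}). charge S = m \<and> energy S = n}"
    then have "S \<in> row_set ` {(as, bs). is_row k as \<and> is_row k bs}"
      using bij_betw_imp_surj_on[OF bij_betw_row_set] by auto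
    then obtain as bs where "S = row_set (as, bs)" "is_row k as" "is_row k bs" by auto
    with S show "S \<in> row_set ` {p. is_row k (fst p) \<and> is_row k (snd p) \<and> weight p = n}"
      by (intro image_eqI[of _ _ "(as, bs)"]) (simp_all add: row_set_stats(1))
  qed
  from finite_surj[OF finite_rows_weight this] show ?thesis .
qed

text \<open>Grouped by energy, the sum over sets of charge \<open>m\<close> has a constant term
  \<open>q ^ n\<close> on each finite fiber, whose size is given by
  \<open>c_psi_eq_card\<close>.\<close>

lemma charge_coeff_sums:
  assumes "norm q < 1"
  shows "(\<lambda>n. of_nat (c_psi k (real_of_int m + real k / 2) n) * q ^ n) sums charge_coeff q {1..k} m"
proof -
  let ?A = "{S \<in> Fpow (sites {1..k}). charge S = m}"
  have "((\<lambda>S. q ^ energy S) has_sum charge_coeff q {1..k} m) ?A"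
    using energy_power_summable[OF assms] by (simp add: charge_coeff_def)
  from has_sum_fibers[OF this, of energy]
  have "((\<lambda>n. \<Sum>\<^sub>\<infinity>S\<in>{S \<in> ?A. energy S = n}. q ^ energy S) has_sum charge_coeff q {1..k} m) UNIV" .
  moreover have "(\<Sum>\<^sub>\<infinity>S\<in>{S \<in> ?A. energy S = n}. q ^ energy S) =
                 of_nat (c_psi k (real_of_int m + real k / 2) n) * q ^ n" for n
  proof -
    have "(\<Sum>\<^sub>\<infinity>S\<in>{S \<in> ?A. energy S = n}. q ^ energy S) = (\<Sum>\<^sub>\<infinity>S\<in>{S \<in> ?A. energy S = n}. q ^ n)"
      by (intro infsum_cong) auto
    then show ?thesis
      using finite_charge_energy[of k m n] by (simp add: c_psi_eq_card conj_assoc)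
  qed
  ultimately show ?thesis by (auto dest: has_sum_imp_sums)
qed

section \<open>The expansion of the theta quotient\<close>

lemma bij_betw_shifted_ints: "bij_betw (\<lambda>m. of_int m + h) UNIV {b::real. b - h \<in> \<int>}"
proof (rule bij_betw_imageI)
  show "range (\<lambda>m. of_int m + h) = {b. b - h \<in> \<int>}"
  proof (intro equalityI subsetI)
    fix b assume "b \<in> {b. b - h \<in> \<int>}"
    then obtain m where "b - h = of_int m" by (auto elim: Ints_cases)
    then show "b \<in> range (\<lambda>m. of_int m + h)" by (intro image_eqI[of _ _ m]) auto
  qed auto
qed (auto simp: inj_on_def)

text \<open>Substituting \<open>b = of_int m + h\<close> turns the expansion into a Laurent series
  in \<open>exp (2 * of_real pi * \<i> * z)\<close> times a factor independent of
  \<open>m\<close>.\<close>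

lemma zeta_expansion_iff:
  "zeta_expansion h f c \<longleftrightarrow>
   (\<forall>z. ((\<lambda>m. c (of_int m + h) * exp (2 * of_real pi * \<i> * z) powi m * exp (2 * of_real pi * \<i> * of_real h * z))
        has_sum f z) UNIV)"
proof -
  have "exp (2 * of_real pi * \<i> * of_real (of_int m + h) * z) =
        exp (2 * of_real pi * \<i> * z) powi m * exp (2 * of_real pi * \<i> * of_real h * z)" for m :: int and z
    by (simp add: exp_power_int exp_add[symmetric] algebra_simps)
  then show ?thesis
    unfolding zeta_expansion_def has_sum_reindex_bij_betw[OF bij_betw_shifted_ints, symmetric]
    by (simp add: mult.assoc)
qed

text \<open>The difference of the two expansions, divided by the common factor \<open>E\<close>, is
  a Laurent series vanishing on the unit circle.\<close>

lemma zeta_expansion_unique: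
  assumes "zeta_expansion h f c" "zeta_expansion h f c'" "a - h \<in> \<int>"
  shows "c a = c' a"
proof -
  obtain m0 where m0: "a = of_int m0 + h"
    using assms(3) by (metis Ints_cases diff_add_cancel)
  have "c (of_int m0 + h) - c' (of_int m0 + h) = 0"
  proof (rule laurent_coeff_eq_0)
    fix \<zeta> :: complex assume "norm \<zeta> = 1"
    then have "\<zeta> \<noteq> 0" by auto
    with \<open>norm \<zeta> = 1\<close> have "\<zeta> = exp (2 * of_real pi * \<i> * of_real (Arg \<zeta> / (2 * pi)))"
      using cis_Arg[of \<zeta>] by (auto simp: cis_conv_exp sgn_div_norm)
    then obtain z where z: "\<zeta> = exp (2 * of_real pi * \<i> * z)" by blast
    define E where "E = exp (2 * of_real pi * \<i> * of_real h * z)"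
    have "((\<lambda>m. c (of_int m + h) * \<zeta> powi m * E + - (c' (of_int m + h) * \<zeta> powi m * E)) has_sum
            (f z + - f z)) UNIV"
      using assms(1,2) by (intro has_sum_add has_sum_uminusI) (auto simp: zeta_expansion_iff z E_def)
    from has_sum_cmult_left[OF this, of "1 / E"]
    show "((\<lambda>m. (c (of_int m + h) - c' (of_int m + h)) * \<zeta> powi m) has_sum 0) UNIV"
      by (simp add: E_def algebra_simps diff_divide_distrib)
  qed
  then show ?thesis by (simp add: m0)
qed

text \<open>Here \<open>charge_coeff_single\<close> identifies the theta quotient with the generating function of
  all finite sets of sites of a single color, which is the Jacobi triple product identity.\<close>

lemma F_fun_eq:
  assumes "Im \<tau> > 0"
  defines "q \<equiv> exp (2 * of_real pi * \<i> * \<tau>)"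
  shows "F_fun k z \<tau> = exp (of_real pi * \<i> * of_nat k * z) *
           subset_prod_sum (monomial q (exp (2 * of_real pi * \<i> * z))) (sites {1..k})"
proof -
  define \<zeta> where "\<zeta> = exp (2 * of_real pi * \<i> * z)"
  define P where "P = (\<Prod>n. 1 - q ^ Suc n)"
  have q: "norm q < 1" "q \<noteq> 0" and \<zeta>: "\<zeta> \<noteq> 0"
    using assms by (auto simp: q_def \<zeta>_def)
  have P: "P \<noteq> 0" unfolding P_def by (rule euler_nonzero[OF q(1)])
  \<comment> \<open>The exponents \<open>1/12\<close> and \<open>1/24\<close> add up to the
    \<open>1/8\<close> that the theta series carries.\<close>
  have eta: "qpow \<tau> (1/12) * eta \<tau> = qpow \<tau> (1/8) * P"
  proof -
    have "qpow \<tau> (real (Suc n)) = q ^ Suc n" for n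
      by (simp add: qpow_def q_def exp_of_nat_mult[symmetric] mult_ac del: of_nat_Suc power_Suc)
    then have "eta \<tau> = qpow \<tau> (1/24) * P" by (simp add: eta_def P_def del: of_nat_Suc power_Suc)
    moreover have "qpow \<tau> (1/12) * qpow \<tau> (1/24) = qpow \<tau> (1/8)"
      by (simp add: qpow_def exp_add[symmetric] field_simps)
    ultimately show ?thesis by simp
  qed
  \<comment> \<open>The two shifts of \<open>z\<close> by \<open>1/2\<close> contribute
    \<open>exp (2 * pi * \<i> * (m + 1/2)) = - 1\<close>, which cancels the sign in
    \<open>F_fun\<close>.\<close>
  have summand: "exp (of_real pi * \<i> * (of_real (of_int m + 1/2))\<^sup>2 * \<tau> +
                 2 * of_real pi * \<i> * of_real (of_int m + 1/2) * (z + 1/2 + 1/2)) =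
        - qpow \<tau> (1/8) * exp (of_real pi * \<i> * z) * P * (q powi theta_exponent m / P * \<zeta> powi m)" for m :: int
  proof -
    have T: "(of_int m + 1/2)\<^sup>2 = 2 * of_int (theta_exponent m) + (1/4 :: complex)"
    proof -
      have "(2 * of_int (theta_exponent m) :: complex) = of_int (2 * theta_exponent m)" by simp
      then show ?thesis unfolding two_theta_exponent by (simp add: power2_eq_square algebra_simps)
    qed
    have "exp (of_real pi * \<i> * (of_real (of_int m + 1/2))\<^sup>2 * \<tau> +
                 2 * of_real pi * \<i> * of_real (of_int m + 1/2) * (z + 1/2 + 1/2)) =
          exp (of_int (theta_exponent m) * (2 * of_real pi * \<i> * \<tau>) + 2 * of_real pi * \<i> * of_real (1/8) * \<tau>
               + of_int m * (2 * of_real pi * \<i> * z) + of_real pi * \<i> * z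
               + (2 * of_real pi * \<i> * of_int m + of_real pi * \<i>))"
      using T by (intro arg_cong[where f = exp]) (simp add: algebra_simps)
    also have "\<dots> = q powi theta_exponent m * qpow \<tau> (1/8) * \<zeta> powi m * exp (of_real pi * \<i> * z) * (- 1)"
      unfolding exp_add q_def \<zeta>_def qpow_def
      by (simp add: exp_power_int exp_integer_2pi mult_ac)
    finally show ?thesis using P by simp
  qed
  have "vartheta (z + 1/2) \<tau> = (\<Sum>\<^sub>\<infinity>m. - qpow \<tau> (1/8) * exp (of_real pi * \<i> * z) * P *
                                      (q powi theta_exponent m / P * \<zeta> powi m))"
    unfolding vartheta_def infsum_reindex_bij_betw[OF bij_betw_shifted_ints, symmetric] summand ..
  also have "\<dots> = - qpow \<tau> (1/8) * exp (of_real pi * \<i> * z) * P *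
                   (\<Sum>\<^sub>\<infinity>m. q powi theta_exponent m / P * \<zeta> powi m)"
    by (rule infsum_cmult_right')
  also have "(\<Sum>\<^sub>\<infinity>m. q powi theta_exponent m / P * \<zeta> powi m) = subset_prod_sum (monomial q \<zeta>) (sites {1})"
  proof (rule infsumI)
    have "((\<lambda>S. \<Prod>x\<in>S. monomial q \<zeta> x) has_sum subset_prod_sum (monomial q \<zeta>) (sites {1}))
            (Fpow (sites {1}))"
      using summable_on_Fpow_prod[OF monomial_abs_summable[OF q(1)]] by (simp add: subset_prod_sum_def)
    from charge_expansion[OF \<zeta> this]
    show "((\<lambda>m. q powi theta_exponent m / P * \<zeta> powi m) has_sum subset_prod_sum (monomial q \<zeta>) (sites {1})) UNIV"
      by (simp only: charge_coeff_def[symmetric] charge_coeff_single[OF q] P_def)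
  qed
  finally have "- vartheta (z + 1/2) \<tau> / (qpow \<tau> (1/12) * eta \<tau>) =
                exp (of_real pi * \<i> * z) * subset_prod_sum (monomial q \<zeta>) (sites {1})"
    unfolding eta using P by (simp add: qpow_def)
  then have "F_fun k z \<tau> = exp (of_real pi * \<i> * z) ^ k * subset_prod_sum (monomial q \<zeta>) (sites {1..k})"
    by (simp only: F_fun_def subset_prod_sum_colors[OF q(1)] power_mult_distrib)
  also have "exp (of_real pi * \<i> * z) ^ k = exp (of_real pi * \<i> * of_nat k * z)"
    by (simp add: exp_of_nat_mult[symmetric] mult_ac)
  finally show ?thesis by (simp only: \<zeta>_def)
qed

text \<open>On the index set \<open>b - real k / 2\<close> is an integer, so the floor only converts
  it to type \<open>int\<close>.\<close>

lemma zeta_expansion_F_fun: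
  assumes "Im \<tau> > 0"
  defines "q \<equiv> exp (2 * of_real pi * \<i> * \<tau>)"
  shows "zeta_expansion (real k / 2) (\<lambda>z. F_fun k z \<tau>) (\<lambda>b. charge_coeff q {1..k} \<lfloor>b - real k / 2\<rfloor>)"
  unfolding zeta_expansion_iff
proof
  fix z
  define \<zeta> where "\<zeta> = exp (2 * of_real pi * \<i> * z)"
  have q: "norm q < 1" and \<zeta>: "\<zeta> \<noteq> 0"
    using assms by (auto simp: q_def \<zeta>_def)
  have "((\<lambda>S. \<Prod>x\<in>S. monomial q \<zeta> x) has_sum subset_prod_sum (monomial q \<zeta>) (sites {1..k}))
          (Fpow (sites {1..k}))"
    using summable_on_Fpow_prod[OF monomial_abs_summable[OF q]] by (simp add: subset_prod_sum_def)
  from has_sum_cmult_left[OF charge_expansion[OF \<zeta> this], of "exp (of_real pi * \<i> * of_nat k * z)"]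
  show "((\<lambda>m. charge_coeff q {1..k} \<lfloor>of_int m + real k / 2 - real k / 2\<rfloor> *
            exp (2 * of_real pi * \<i> * z) powi m * exp (2 * of_real pi * \<i> * of_real (real k / 2) * z))
         has_sum F_fun k z \<tau>) UNIV"
    unfolding F_fun_eq[OF assms(1)] q_def[symmetric] \<zeta>_def[symmetric] charge_coeff_def[symmetric]
    by (simp add: mult_ac)
qed

theorem theorem1:
  fixes k :: nat and a :: real and \<tau> :: complex
  assumes "k > 0" and "a - real k / 2 \<in> \<int>" and "a \<ge> 0" and "Im \<tau> > 0"
  shows "(\<exists>c. zeta_expansion (real k / 2) (\<lambda>z. F_fun k z \<tau>) c) \<and>
         (\<forall>c. zeta_expansion (real k / 2) (\<lambda>z. F_fun k z \<tau>) c \<longrightarrow>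
              (\<lambda>n. fps_nth (C_Psi k a) n * exp (2 * of_real pi * \<i> * \<tau>) ^ n) sums c a) \<and>
         C_Psi k (real k / 2) = C_Phi k"
proof (intro conjI allI impI)
  define q where "q = exp (2 * of_real pi * \<i> * \<tau>)"
  note ex = zeta_expansion_F_fun[OF assms(4), of k, folded q_def]
  from ex show "\<exists>c. zeta_expansion (real k / 2) (\<lambda>z. F_fun k z \<tau>) c" by blast
  fix c assume c: "zeta_expansion (real k / 2) (\<lambda>z. F_fun k z \<tau>) c"
  obtain m where m: "a = of_int m + real k / 2"
    using assms(2) by (metis Ints_cases diff_add_cancel)
  have "norm q < 1" using assms(4) by (simp add: q_def)
  then have "(\<lambda>n. of_nat (c_psi k a n) * q ^ n) sums charge_coeff q {1..k} m"
    unfolding m by (rule charge_coeff_sums)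
  \<comment> \<open>By uniqueness \<open>c\<close> agrees at \<open>a\<close> with the explicit
    expansion, where the floor is \<open>m\<close>.\<close>
  moreover have "c a = charge_coeff q {1..k} m"
    using zeta_expansion_unique[OF c ex assms(2)] by (simp add: m)
  ultimately show "(\<lambda>n. fps_nth (C_Psi k a) n * exp (2 * of_real pi * \<i> * \<tau>) ^ n) sums c a"
    by (simp add: C_Psi_def q_def)
next
  have "F_partitions k (real k / 2) = Frobenius_partitions k"
    by (auto simp: F_partitions_def Frobenius_partitions_def)
  then show "C_Psi k (real k / 2) = C_Phi k"
    by (simp add: C_Psi_def C_Phi_def c_psi_def c_phi_def)
qed

end
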